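(* Consider the event-triggered consensus protocol $$\dot{\mathbf z}(t)=\mathbf f'\big(t,\mathbf z(t),\mathbf m(\mathbf z(t))+\mathbf u(t)\big)=:\mathbf f(t,\mathbf z(t),\mathbf u(t)),\qquad \mathbf u_j(t)=\mathbf m_j(\mathbf z_j(\tau_t^j))-\mathbf m_j(\mathbf z_j(t)),\ j\in\mathcal V,$$ with disagreement vector $\mathbf x(t)=(\mathbf H\otimes\mathbf I_n)\mathbf z(t)$ and disagreement dynamics $\dot{\mathbf x}(t)=\mathbf h(t,\mathbf x(t),\mathbf u(t)):=(\mathbf H\otimes\mathbf I_n)\dot{\mathbf z}(t)$. Suppose that: (i) the functions $\{\mathbf f_i,\mathbf m_i\}_{i\in\mathcal V}$ ensure existence of solutions, for all $t\ge 0$, of the protocol with continuous communication $\dot{\mathbf z}_i(t)=\mathbf f_i(t,\mathbf z_i(t),\{\mathbf m_j(\mathbf z_j(t))\}_{j\in\mathcal N_i'})$, $i\in\mathcal V$; (ii) the event-triggering mechanism (ETM) guarantees a minimum inter-event time; (iii) the disagreement dynamics $\dot{\mathbf x}=\mathbf h(t,\mathbf x,\mathbf u)$ are input-to-state practically stable (ISpS); (iv) the disturbance $\mathbf u(t)$ produced by the ETM has a uniformly bounded Euclidean norm for all $t\ge 0$. Then there exists $\xi\ge 0$ such that for all initial conditions $\mathbf x(0)$, the consensus error $\mathbf x(t)$ is bounded for all $t\geq 0$, with $\limsup_{t\to\infty}\|\mathbf x(t)\|\le \xi$.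
   Context: Network: $N$ agents connected by an undirected connected graph $\mathcal G=(\mathcal V,\mathcal E)$, $\mathcal V=\{1,\dots,N\}$; $\mathcal N_i$ is the neighbor set of agent $i$ and $\mathcal N_i'=\mathcal N_i\cup\{i\}$. $\|\cdot\|$ is the Euclidean norm, $\mathbf I_n$ the identity, $\mathds{1}_N$ the all-ones vector, $\otimes$ the Kronecker product. Protocol: agent $i$ has state $\mathbf z_i(t)\in\mathbb R^n$ and output message function $\mathbf m_i$. With continuous communication, $\dot{\mathbf z}_i(t)=\mathbf f_i(t,\mathbf z_i(t),\{\mathbf m_j(\mathbf z_j(t))\}_{j\in\mathcal N_i'})$. With event-triggered communication, agent $j$ transmits only at its event instants $\tau_0^j<\tau_1^j<\dots$ generated by an event-triggering mechanism (ETM), and $\dot{\mathbf z}_i(t)=\mathbf f_i(t,\mathbf z_i(t),\{\mathbf m_j(\mathbf z_j(\tau_t^j))\}_{j\in\mathcal N_i'})$, where $\tau_t^j=\max\{\tau_k^j: \tau_k^j\le t\}$ is the last event of agent $j$ up to time $t$ (with $\tau_0^j=0$). Stack $\mathbf z=[\mathbf z_1^\top,\dots,\mathbf z_N^\top]^\top$, $\mathbf m(\mathbf z)=[\mathbf m_1(\mathbf z_1)^\top,\dots,\mathbf m_N(\mathbf z_N)^\top]^\top$, $\mathbf u=[\mathbf u_1^\top,\dots,\mathbf u_N^\top]^\top$; $\mathbf f'$ is the stacked vector field, so that the continuous-communication protocol is $\dot{\mathbf z}=\mathbf f'(t,\mathbf z,\mathbf m(\mathbf z))$. Disagreement: $\mathbf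 H=\mathbf I_N-(1/N)\mathds{1}_N\mathds{1}_N^\top$, and $\mathbf z(t)=(\mathds{1}_N\otimes\mathbf I_n)\bar{\mathbf z}(t)+\mathbf x(t)$ with $\bar{\mathbf z}(t)=(1/N)\sum_i\mathbf z_i(t)$. Minimum inter-event time: there is $\tau>0$ with $\tau_{k+1}^i-\tau_k^i\ge\tau$ for all $i\in\mathcal V$, $k\ge 0$. Uniform boundedness of $\mathbf u$: there is a constant $U\geq 0$, not depending on the trajectory, with $\|\mathbf u(t)\|\le U$ for all $t\ge 0$. ISpS: a system $\dot{\mathbf x}=\mathbf h(t,\mathbf x,\mathbf u)$ is ISpS if there exist a class $\mathcal{KL}$ function $\beta$, a class $\mathcal K_\infty$ function $\gamma$ and a constant $c$ such that for any initial state $\mathbf x(0)$ and bounded input $\mathbf u$, the solution satisfies $\|\mathbf x(t)\|\le\beta(\|\mathbf x(0)\|,t)+\gamma\big(\sup_{s\in[0,t]}\|\mathbf u(s)\|\big)+c$. ($\mathcal K_\infty$: continuous, strictly increasing, unbounded functions $[0,\infty)\to[0,\infty)$ vanishing at $0$. $\mathcal{KL}$: continuous $\beta(r,t)$ that, for fixed $t$, is strictly increasing in $r$ and zero at $r=0$, and for fixed $r$ is decreasing in $t$ with limit $0$.) *)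

theory Defs
  imports "HOL-Analysis.Analysis"
begin

text \<open>The agents are the elements of a finite type \<open>'v\<close>. A stacked vector is a vector of vectors
  such as \<open>real^'n^'v\<close>, whose library norm is the Euclidean norm of the concatenation.\<close>

definition connected_graph :: "('v \<times> 'v) set \<Rightarrow> bool" where
  "connected_graph E \<longleftrightarrow> sym E \<and> irrefl E \<and> E\<^sup>* = UNIV"

definition closed_nbhd :: "('v \<times> 'v) set \<Rightarrow> 'v \<Rightarrow> 'v set" where
  "closed_nbhd E i = insert i {j. (i, j) \<in> E}"

definition stack_msg :: "('v \<Rightarrow> real^'n \<Rightarrow> real^'p) \<Rightarrow> real^'n^'v \<Rightarrow> real^'p^'v" where
  "stack_msg m z = (\<chi> j. m j (z $ j))"

text \<open>The family of messages available to agent \<open>i\<close> is a function on its closed neighbourhood only;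
  \<open>restrict\<close> erases all other messages, so that \<open>f i\<close> cannot depend on them.\<close>

definition stack_field ::
  "('v \<times> 'v) set \<Rightarrow> ('v \<Rightarrow> real \<Rightarrow> real^'n \<Rightarrow> ('v \<Rightarrow> real^'p) \<Rightarrow> real^'n) \<Rightarrow>
   real \<Rightarrow> real^'n^'v \<Rightarrow> real^'p^'v \<Rightarrow> real^'n^'v" where
  "stack_field E f t z M = (\<chi> i. f i t (z $ i) (restrict (\<lambda>j. M $ j) (closed_nbhd E i)))"

definition perturbed_field ::
  "('v \<times> 'v) set \<Rightarrow> ('v \<Rightarrow> real \<Rightarrow> real^'n \<Rightarrow> ('v \<Rightarrow> real^'p) \<Rightarrow> real^'n) \<Rightarrow>
   ('v \<Rightarrow> real^'n \<Rightarrow> real^'p) \<Rightarrow> real \<Rightarrow> real^'n^'v \<Rightarrow> real^'p^'v \<Rightarrow> real^'n^'v" where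
  "perturbed_field E f m t z u = stack_field E f t z (stack_msg m z + u)"

text \<open>Solutions on \<open>[0,\<infinity>)\<close> are meant in the sense of Caratheodory, because under event-triggered
  communication the right-hand side jumps at the event instants.\<close>

definition ode_solution :: "(real \<Rightarrow> 'x \<Rightarrow> 'x) \<Rightarrow> (real \<Rightarrow> 'x::euclidean_space) \<Rightarrow> bool" where
  "ode_solution g x \<longleftrightarrow> (\<forall>t\<ge>0. (\<lambda>s. g s (x s)) absolutely_integrable_on {0..t} \<and>
                              x t = x 0 + integral {0..t} (\<lambda>s. g s (x s)))"

definition event_times :: "('v \<Rightarrow> nat \<Rightarrow> real) \<Rightarrow> bool" where
  "event_times \<tau> \<longleftrightarrow> (\<forall>j. \<tau> j 0 = 0 \<and> strict_mono (\<tau> j))"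

definition last_event :: "('v \<Rightarrow> nat \<Rightarrow> real) \<Rightarrow> 'v \<Rightarrow> real \<Rightarrow> real" where
  "last_event \<tau> j t = Max {\<tau> j k | k. \<tau> j k \<le> t}"

definition min_inter_event_time :: "('v \<Rightarrow> nat \<Rightarrow> real) \<Rightarrow> bool" where
  "min_inter_event_time \<tau> \<longleftrightarrow> (\<exists>T>0. \<forall>i k. \<tau> i (Suc k) - \<tau> i k \<ge> T)"

definition event_disturbance ::
  "('v \<Rightarrow> real^'n \<Rightarrow> real^'p) \<Rightarrow> ('v \<Rightarrow> nat \<Rightarrow> real) \<Rightarrow> (real \<Rightarrow> real^'n^'v) \<Rightarrow> real \<Rightarrow> real^'p^'v" where
  "event_disturbance m \<tau> z t = (\<chi> j. m j (z (last_event \<tau> j t) $ j) - m j (z t $ j))"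

text \<open>An event-triggering mechanism is a relation: \<open>etm z \<tau>\<close> says that, along the trajectory \<open>z\<close>,
  it may generate the event instants \<open>\<tau>\<close>.\<close>

definition event_triggered_run ::
  "('v::finite \<times> 'v) set \<Rightarrow> ('v \<Rightarrow> real \<Rightarrow> real^'n \<Rightarrow> ('v \<Rightarrow> real^'p) \<Rightarrow> real^'n) \<Rightarrow>
   ('v \<Rightarrow> real^'n \<Rightarrow> real^'p) \<Rightarrow> ((real \<Rightarrow> real^'n^'v) \<Rightarrow> ('v \<Rightarrow> nat \<Rightarrow> real) \<Rightarrow> bool) \<Rightarrow>
   (real \<Rightarrow> real^'n^'v) \<Rightarrow> ('v \<Rightarrow> nat \<Rightarrow> real) \<Rightarrow> bool" where
  "event_triggered_run E f m etm z \<tau> \<longleftrightarrow>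
     event_times \<tau> \<and> etm z \<tau> \<and>
     ode_solution (\<lambda>t y. perturbed_field E f m t y (event_disturbance m \<tau> z t)) z"

definition centering :: "real^'v^'v" where
  "centering = mat 1 - (1 / real CARD('v)) *\<^sub>R (\<chi> i j. 1)"

text \<open>The action of the Kronecker product \<open>A \<otimes> I\<close> on a stacked vector.\<close>

definition kron_id :: "real^'v^'v \<Rightarrow> real^'n^'v \<Rightarrow> real^'n^'v" where
  "kron_id A z = (\<chi> i. \<Sum>j\<in>UNIV. (A $ i $ j) *\<^sub>R (z $ j))"

definition disagreement :: "real^'n^'v \<Rightarrow> real^'n^'v" where
  "disagreement z = kron_id centering z"

definition average :: "real^'n^'v \<Rightarrow> real^'n" where
  "average z = (1 / real CARD('v)) *\<^sub>R (\<Sum>i\<in>UNIV. z $ i)"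

definition class_Kinf :: "(real \<Rightarrow> real) \<Rightarrow> bool" where
  "class_Kinf \<gamma> \<longleftrightarrow> continuous_on {0..} \<gamma> \<and> strict_mono_on {0..} \<gamma> \<and> \<gamma> 0 = 0 \<and>
                   \<not> bdd_above (\<gamma> ` {0..})"

definition class_KL :: "(real \<Rightarrow> real \<Rightarrow> real) \<Rightarrow> bool" where
  "class_KL \<beta> \<longleftrightarrow> continuous_on ({0..} \<times> {0..}) (\<lambda>(r, t). \<beta> r t) \<and>
     (\<forall>t\<ge>0. strict_mono_on {0..} (\<lambda>r. \<beta> r t) \<and> \<beta> 0 t = 0) \<and>
     (\<forall>r\<ge>0. antimono_on {0..} (\<beta> r) \<and> (\<beta> r \<longlongrightarrow> 0) at_top)"

text \<open>A system is given by its solutions: \<open>sol u x\<close> says that \<open>x\<close> is a solution for the input \<open>u\<close>.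
  For \<open>x' = h(t,x,u)\<close> this is \<open>ode_solution (\<lambda>t y. h t y (u t)) x\<close>.\<close>

definition isps ::
  "((real \<Rightarrow> 'u::real_normed_vector) \<Rightarrow> (real \<Rightarrow> 'x::real_normed_vector) \<Rightarrow> bool) \<Rightarrow> bool" where
  "isps sol \<longleftrightarrow> (\<exists>\<beta> \<gamma> c. class_KL \<beta> \<and> class_Kinf \<gamma> \<and>
     (\<forall>u x. bounded (u ` {0..}) \<and> sol u x \<longrightarrow>
        (\<forall>t\<ge>0. norm (x t) \<le> \<beta> (norm (x 0)) t + \<gamma> (SUP s\<in>{0..t}. norm (u s)) + c)))"

text \<open>Solutions of the disagreement dynamics \<open>x' = (H \<otimes> I) z'\<close> with \<open>z' = F(t,z,u)\<close>. In general
  \<open>(H \<otimes> I) F(t,z,u)\<close> depends on \<open>z\<close> not only through \<open>x\<close>: it is a function of \<open>t\<close>, \<open>x(t)\<close> and \<open>u(t)\<close>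
  once the average of \<open>z\<close> is regarded as a function of time (\<open>disagreement_solution_imp_ode\<close>). If it
  does depend on \<open>z\<close> through \<open>x\<close> only, then it is enough that the resulting closed system on the
  disagreement subspace is ISpS (\<open>isps_closed_disagreement\<close>).\<close>

definition disagreement_solution ::
  "(real \<Rightarrow> real^'n^'v \<Rightarrow> real^'p^'v \<Rightarrow> real^'n^'v) \<Rightarrow>
   (real \<Rightarrow> real^'p^'v) \<Rightarrow> (real \<Rightarrow> real^'n^'v) \<Rightarrow> bool" where
  "disagreement_solution F u x \<longleftrightarrow>
     (\<exists>z. ode_solution (\<lambda>t y. F t y (u t)) z \<and> x = (\<lambda>t. disagreement (z t)))"

lemma bounded_linear_disagreement:
  "bounded_linear (disagreement :: real^'n^'v \<Rightarrow> real^'n^'v)"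
proof -
  have "linear (disagreement :: real^'n^'v \<Rightarrow> real^'n^'v)"
    by (rule linearI)
      (simp_all add: disagreement_def kron_id_def vec_eq_iff sum.distrib distrib_left
        sum_distrib_left ac_simps)
  then show ?thesis
    by (simp add: linear_conv_bounded_linear)
qed

lemma average_plus_disagreement:
  fixes z :: "real^'n^'v"
  shows "(\<chi> i. average z) + disagreement z = z"
proof -
  have "(\<Sum>j\<in>UNIV. ((if i = j then 1 else 0) - 1 / real CARD('v)) * z $ j $ k) =
        z $ i $ k - (\<Sum>j\<in>UNIV. z $ j $ k) / real CARD('v)" for i k
    by (simp add: left_diff_distrib sum_subtractf sum_divide_distrib if_distrib[of "\<lambda>a. a * _"]
        cong: if_cong)
  then show ?thesis
    by (simp add: vec_eq_iff average_def disagreement_def kron_id_def centering_def mat_def)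
qed

lemma ode_solution_disagreement:
  fixes z :: "real \<Rightarrow> real^'n^'v"
  assumes z: "ode_solution g z"
    and h: "\<And>t. t \<ge> 0 \<Longrightarrow> disagreement (g t (z t)) = h t (disagreement (z t))"
  shows "ode_solution h (\<lambda>t. disagreement (z t))"
  unfolding ode_solution_def
proof (intro allI impI)
  fix t :: real
  assume t: "0 \<le> t"
  let ?g = "\<lambda>s. g s (z s)"
  let ?h = "\<lambda>s. h s (disagreement (z s))"
  have gi: "?g absolutely_integrable_on {0..t}" and zt: "z t = z 0 + integral {0..t} ?g"
    using z t unfolding ode_solution_def by blast+
  note bl = bounded_linear_disagreement[where 'n='n and 'v='v]
  have eq: "(disagreement \<circ> ?g) s = ?h s" if "s \<in> {0..t}" for s
    using that h by simp
  have "(disagreement \<circ> ?g) absolutely_integrable_on {0..t}"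
    by (rule absolutely_integrable_linear[OF gi bl])
  moreover have "indicator {0..t} s *\<^sub>R (disagreement \<circ> ?g) s = indicator {0..t} s *\<^sub>R ?h s" for s
    by (cases "s \<in> {0..t}") (simp_all only: eq indicator_simps scaleR_zero_left not_False_eq_True)
  ultimately have 1: "?h absolutely_integrable_on {0..t}"
    unfolding set_integrable_def by (simp only:)
  have "disagreement (z t) = disagreement (z 0) + disagreement (integral {0..t} ?g)"
    unfolding zt by (rule linear_add[OF bounded_linear.linear[OF bl]])
  also have "disagreement (integral {0..t} ?g) = integral {0..t} (disagreement \<circ> ?g)"
    by (rule integral_linear[OF set_lebesgue_integral_eq_integral(1)[OF gi] bl, symmetric])
  also have "\<dots> = integral {0..t} ?h"
    by (rule integral_cong) (rule eq)
  finally show "?h absolutely_integrable_on {0..t} \<and>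
      disagreement (z t) = disagreement (z 0) + integral {0..t} ?h"
    using 1 by (intro conjI)
qed

lemma disagreement_solution_imp_ode:
  assumes "disagreement_solution F u x"
  shows "\<exists>w. ode_solution (\<lambda>t y. disagreement (F t ((\<chi> i. w t) + y) (u t))) x"
proof -
  obtain z where z: "ode_solution (\<lambda>t y. F t y (u t)) z" and x: "x = (\<lambda>t. disagreement (z t))"
    using assms by (auto simp: disagreement_solution_def)
  have "ode_solution (\<lambda>t y. disagreement (F t ((\<chi> i. average (z t)) + y) (u t)))
          (\<lambda>t. disagreement (z t))"
    by (rule ode_solution_disagreement[OF z]) (simp add: average_plus_disagreement)
  then show ?thesis
    unfolding x by (intro exI[of _ "\<lambda>t. average (z t)"])
qed

lemma isps_closed_disagreement:
  assumes h: "\<And>t z u. disagreement (F t z u) = h t (disagreement z) u"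
    and isps: "isps (\<lambda>u x. ode_solution (\<lambda>t y. h t y (u t)) x \<and> (\<forall>t. x t \<in> range disagreement))"
  shows "isps (disagreement_solution F)"
proof -
  have *: "ode_solution (\<lambda>t y. h t y (u t)) x \<and> (\<forall>t. x t \<in> range disagreement)"
    if sol: "disagreement_solution F u x" for u x
  proof -
    obtain z where z: "ode_solution (\<lambda>t y. F t y (u t)) z" and x: "x = (\<lambda>t. disagreement (z t))"
      using sol unfolding disagreement_solution_def by blast
    have "ode_solution (\<lambda>t y. h t y (u t)) x"
      unfolding x by (rule ode_solution_disagreement[OF z]) (rule h)
    then show ?thesis
      by (simp add: x)
  qed
  obtain \<beta> \<gamma> c where "class_KL \<beta>" "class_Kinf \<gamma>"
    and "\<And>u x t. bounded (u ` {0..}) \<Longrightarrow> ode_solution (\<lambda>t y. h t y (u t)) x \<and>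
           (\<forall>t. x t \<in> range disagreement) \<Longrightarrow> t \<ge> 0 \<Longrightarrow>
           norm (x t) \<le> \<beta> (norm (x 0)) t + \<gamma> (SUP s\<in>{0..t}. norm (u s)) + c"
    using isps unfolding isps_def by blast
  then show ?thesis
    unfolding isps_def by (intro exI[of _ \<beta>] exI[of _ \<gamma>] exI[of _ c]) (use * in blast)
qed

end

theory Submission
  imports Defs
begin

text \<open>For fixed \<open>r\<close> the transient \<beta> is nonincreasing in time, so its value
  at time 0 dominates it throughout and no continuity of \<open>x\<close> is needed for boundedness.
  It also tends to 0, so only the offset \<open>d\<close> survives in the limit superior.\<close>

lemma class_KL_bound_limit:
  assumes \<beta>: "class_KL \<beta>" and r: "r \<ge> 0"
    and bound: "\<And>t. t \<ge> 0 \<Longrightarrow> norm (x t) \<le> \<beta> r t + d"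
  shows "bounded (x ` {0..})"
    and "Limsup at_top (\<lambda>t. ereal (norm (x t))) \<le> ereal d"
proof -
  have anti: "antimono_on {0..} (\<beta> r)" and lim: "(\<beta> r \<longlongrightarrow> 0) at_top"
    using \<beta> r by (auto simp: class_KL_def)
  have "norm (x t) \<le> \<beta> r 0 + d" if "t \<ge> 0" for t
    using bound[OF that] monotone_onD[OF anti, of 0 t] that by auto
  then show "bounded (x ` {0..})"
    by (auto simp: bounded_iff)
  have "((\<lambda>t. \<beta> r t + d) \<longlongrightarrow> 0 + d) at_top"
    by (intro tendsto_intros lim)
  then have "((\<lambda>t. ereal (\<beta> r t + d)) \<longlongrightarrow> ereal d) at_top"
    by simp
  then have "Limsup at_top (\<lambda>t. ereal (\<beta> r t + d)) = ereal d"
    by (intro lim_imp_Limsup) auto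
  \<comment> \<open>The estimate is available only for nonnegative times, which is enough because
    \<open>Limsup\<close> at infinity sees only eventual behaviour.\<close>
  moreover have "Limsup at_top (\<lambda>t. ereal (norm (x t))) \<le> Limsup at_top (\<lambda>t. ereal (\<beta> r t + d))"
    by (intro Limsup_mono eventually_mono[OF eventually_ge_at_top[of 0]]) (use bound in auto)
  ultimately show "Limsup at_top (\<lambda>t. ereal (norm (x t))) \<le> ereal d"
    by simp
qed

text \<open>The bound \<open>\<xi>\<close> depends on the input bound \<open>U\<close> only: the transient \<open>\<beta>\<close> carries the dependence on
  the initial state and vanishes in the limit.\<close>

lemma isps_ultimate_bound:
  fixes sol :: "(real \<Rightarrow> 'u::real_normed_vector) \<Rightarrow> (real \<Rightarrow> 'x::real_normed_vector) \<Rightarrow> bool"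
  assumes isps: "isps sol" and U: "U \<ge> 0"
  shows "\<exists>\<xi>\<ge>0. \<forall>u x. sol u x \<and> (\<forall>t\<ge>0. norm (u t) \<le> U) \<longrightarrow>
           bounded (x ` {0..}) \<and> Limsup at_top (\<lambda>t. ereal (norm (x t))) \<le> ereal \<xi>"
proof -
  obtain \<beta> \<gamma> c where \<beta>: "class_KL \<beta>" and \<gamma>: "class_Kinf \<gamma>"
    and est: "\<And>u x t. bounded (u ` {0..}) \<Longrightarrow> sol u x \<Longrightarrow> t \<ge> 0 \<Longrightarrow>
           norm (x t) \<le> \<beta> (norm (x 0)) t + \<gamma> (SUP s\<in>{0..t}. norm (u s)) + c"
    using isps unfolding isps_def by blast
  have mono: "mono_on {0..} \<gamma>"
    using \<gamma> by (auto simp: class_Kinf_def intro: strict_mono_on_imp_mono_on)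
  \<comment> \<open>The constant \<open>c\<close> of the ISpS estimate may be negative; the maximum
    with 0 keeps \<xi> nonnegative.\<close>
  define \<xi> where "\<xi> = max 0 (\<gamma> U + c)"
  have "bounded (x ` {0..}) \<and> Limsup at_top (\<lambda>t. ereal (norm (x t))) \<le> ereal \<xi>"
    if sol: "sol u x" and u: "\<forall>t\<ge>0. norm (u t) \<le> U" for u x
  proof -
    have "norm (x t) \<le> \<beta> (norm (x 0)) t + \<xi>" if t: "t \<ge> 0" for t
    proof -
      let ?S = "SUP s\<in>{0..t}. norm (u s)"
      \<comment> \<open>\<gamma> is monotone only on the nonnegative reals, so the supremum must
        first be placed there. Time 0 belongs to every interval \<open>{0..t}\<close>, so the norm
        at that time is a nonnegative lower bound.\<close>
      have "norm (u 0) \<le> ?S"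
        using t u by (intro cSUP_upper bdd_aboveI2[where M = U]) auto
      then have "0 \<le> ?S"
        using norm_ge_zero order_trans by blast
      moreover have "?S \<le> U"
        using t u by (intro cSUP_least) auto
      ultimately have "\<gamma> ?S \<le> \<gamma> U"
        using U by (intro mono_onD[OF mono]) auto
      moreover have "bounded (u ` {0..})"
        using u by (auto simp: bounded_iff)
      ultimately show ?thesis
        using est[OF _ sol t] by (fastforce simp: \<xi>_def)
    qed
    then show ?thesis
      using class_KL_bound_limit[OF \<beta> norm_ge_zero] by blast
  qed
  then show ?thesis
    by (intro exI[of _ \<xi>]) (auto simp: \<xi>_def)
qed

theorem theorem1:
  fixes E :: "('v::finite \<times> 'v) set"
    and f :: "'v \<Rightarrow> real \<Rightarrow> real^'n \<Rightarrow> ('v \<Rightarrow> real^'p) \<Rightarrow> real^'n"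
    and m :: "'v \<Rightarrow> real^'n \<Rightarrow> real^'p"
    and etm :: "(real \<Rightarrow> real^'n^'v) \<Rightarrow> ('v \<Rightarrow> nat \<Rightarrow> real) \<Rightarrow> bool"
  assumes graph: "connected_graph E"
    and existence: "\<And>z0. \<exists>z. z 0 = z0 \<and> ode_solution (\<lambda>t y. stack_field E f t y (stack_msg m y)) z"
    and miet: "\<And>z \<tau>. event_triggered_run E f m etm z \<tau> \<Longrightarrow> min_inter_event_time \<tau>"
    and isps: "isps (disagreement_solution (perturbed_field E f m))"
    and disturbance: "\<exists>U\<ge>0. \<forall>z \<tau>. event_triggered_run E f m etm z \<tau> \<longrightarrow>
                        (\<forall>t\<ge>0. norm (event_disturbance m \<tau> z t) \<le> U)"
  shows "\<exists>\<xi>\<ge>0. \<forall>z \<tau>. event_triggered_run E f m etm z \<tau> \<longrightarrow>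
           bounded ((\<lambda>t. disagreement (z t)) ` {0..}) \<and>
           Limsup at_top (\<lambda>t. ereal (norm (disagreement (z t)))) \<le> ereal \<xi>"
proof -
  obtain U where U: "U \<ge> 0"
    and dist: "\<And>z \<tau> t. event_triggered_run E f m etm z \<tau> \<Longrightarrow> t \<ge> 0 \<Longrightarrow>
      norm (event_disturbance m \<tau> z t) \<le> U"
    using disturbance by blast
  \<comment> \<open>Although the disturbance is generated by feedback from \<open>z\<close>, along a
    given run it is a fixed function of time. The run thus solves the perturbed system for this
    input, with \<open>z\<close> itself as witness, and ISpS covers every bounded input. Since
    \<open>U\<close> was fixed before the run, the resulting \<xi> serves all runs.\<close>
  have "disagreement_solution (perturbed_field E f m) (event_disturbance m \<tau> z)
          (\<lambda>t. disagreement (z t))" if "event_triggered_run E f m etm z \<tau>" for z \<tau>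
    using that unfolding event_triggered_run_def disagreement_solution_def by blast
  with dist isps_ultimate_bound[OF isps U] show ?thesis
    by meson
qed

end
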